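(* Let $X_1,X_2,\ldots$ be independent, identically distributed real random variables with cumulative distribution function $F$, and let $x\in\mathbb{R}$. For each sample size $n\ge 2$ define 1. $F_{n_1}(x)=\frac{1}{n+1}\sum_{i=1}^{n}\mathbf 1(X_i\le x)$, 2. $F_{n_2}(x)=\frac{1}{n+1/3}\left(\sum_{i=1}^{n}\mathbf 1(X_i\le x)-\frac13\right)$, 3. $F_{n_3}(x)=\frac{1}{n-1}\left(\sum_{i=1}^{n}\mathbf 1(X_i\le x)-1\right)$, 4. $F_{n_4}(x)=\frac{1}{n}\left(\sum_{i=1}^{n}\mathbf 1(X_i\le x)-\frac12\right)$. Then each of $F_{n_1}(x)$, $F_{n_2}(x)$, $F_{n_3}(x)$ and $F_{n_4}(x)$ is a consistent estimator of $F(x)$; that is, for each $k\in\{1,2,3,4\}$, $F_{n_k}(x)\to F(x)$ in probability as $n\to\infty$.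
   Context: $\mathbf 1(A)$ denotes the indicator function of the event $A$. The notation $F_{n_k}(x)$, $k=1,2,3,4$, denotes four different estimators, each based on the sample $X_1,\ldots,X_n$ of size $n$ (the subscript $k$ labels the estimator; it does not denote a subsequence). A sequence of estimators $T_n$ (with $T_n$ a function of the sample of size $n$) is consistent for a quantity $\theta$ if $T_n\to\theta$ in probability as $n\to\infty$. *)

theory Defs
  imports "HOL-Probability.Probability"
begin

(* Measurability is part of the definition because measure M assigns 0 to
   non-measurable sets. *)
definition tendsto_in_prob :: "'a measure \<Rightarrow> (nat \<Rightarrow> 'a \<Rightarrow> real) \<Rightarrow> real \<Rightarrow> bool" where
  "tendsto_in_prob M T c \<longleftrightarrow>
     (\<forall>n. T n \<in> borel_measurable M) \<and>
     (\<forall>\<epsilon>>0. (\<lambda>n. measure M {\<omega> \<in> space M. \<bar>T n \<omega> - c\<bar> > \<epsilon>}) \<longlonglongrightarrow> 0)"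

(* The observations are X 1, X 2, ...; the estimator T n only receives the restriction of
   the sample to the indices 1..n. *)
definition consistent_estimator ::
    "'a measure \<Rightarrow> (nat \<Rightarrow> 'a \<Rightarrow> real) \<Rightarrow> (nat \<Rightarrow> (nat \<Rightarrow> real) \<Rightarrow> real) \<Rightarrow> real \<Rightarrow> bool" where
  "consistent_estimator M X T \<theta> \<longleftrightarrow>
     tendsto_in_prob M (\<lambda>n \<omega>. T n (\<lambda>i\<in>{1..n}. X i \<omega>)) \<theta>"

(* Intended for n \<ge> 2; the values for smaller n are irrelevant to the limit (F_est3 divides
   by zero at n = 1). *)
definition F_est1 :: "real \<Rightarrow> nat \<Rightarrow> (nat \<Rightarrow> real) \<Rightarrow> real" where
  "F_est1 x n s = 1 / (real n + 1) * (\<Sum>i=1..n. of_bool (s i \<le> x))"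

definition F_est2 :: "real \<Rightarrow> nat \<Rightarrow> (nat \<Rightarrow> real) \<Rightarrow> real" where
  "F_est2 x n s = 1 / (real n + 1 / 3) * ((\<Sum>i=1..n. of_bool (s i \<le> x)) - 1 / 3)"

definition F_est3 :: "real \<Rightarrow> nat \<Rightarrow> (nat \<Rightarrow> real) \<Rightarrow> real" where
  "F_est3 x n s = 1 / (real n - 1) * ((\<Sum>i=1..n. of_bool (s i \<le> x)) - 1)"

definition F_est4 :: "real \<Rightarrow> nat \<Rightarrow> (nat \<Rightarrow> real) \<Rightarrow> real" where
  "F_est4 x n s = 1 / real n * ((\<Sum>i=1..n. of_bool (s i \<le> x)) - 1 / 2)"

end

(* Each estimator is an affine image a n * U n + b n of the relative frequency U n of the
   event X i <= x, with a n -> 1 and b n -> 0.  By Hoeffding's inequality U n converges to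
   F x in probability, and such affine changes preserve the limit. *)
theory Submission
  imports Defs "HOL-Real_Asymp.Real_Asymp"
begin

text \<open>The error splits into the random part \<open>a n * (T n \<omega> - c)\<close> and the
  deterministic part \<open>a n * c + b n - (a0 * c + b0)\<close>. The first is controlled because
  \<open>a\<close> is eventually bounded, the second because it tends to 0.\<close>

lemma tendsto_in_prob_affine:
  fixes a b :: "nat \<Rightarrow> real"
  assumes "prob_space M" and T: "tendsto_in_prob M T c"
    and a: "a \<longlonglongrightarrow> a0" and b: "b \<longlonglongrightarrow> b0"
  shows "tendsto_in_prob M (\<lambda>n \<omega>. a n * T n \<omega> + b n) (a0 * c + b0)"
  unfolding tendsto_in_prob_def
proof (intro conjI allI impI)
  interpret prob_space M by fact
  have [measurable]: "T n \<in> borel_measurable M" for n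
    using T by (simp add: tendsto_in_prob_def)
  show "(\<lambda>\<omega>. a n * T n \<omega> + b n) \<in> borel_measurable M" for n
    by measurable
  fix \<epsilon> :: real assume "\<epsilon> > 0"
  \<comment> \<open>Adding 1 makes \<open>K\<close> a strict eventual bound for
    \<open>\<bar>a n\<bar>\<close> and keeps it positive even if \<open>a0 = 0\<close>, so that
    dividing by \<open>K\<close> is safe.\<close>
  define K where "K = \<bar>a0\<bar> + 1"
  have "K > 0" by (simp add: K_def)
  have "(\<lambda>n. \<bar>a n\<bar>) \<longlonglongrightarrow> \<bar>a0\<bar>"
    using a by (intro tendsto_intros)
  then have 1: "\<forall>\<^sub>F n in sequentially. \<bar>a n\<bar> < K"
    by (rule order_tendstoD) (simp add: K_def)
  have "(\<lambda>n. \<bar>a n * c + b n - (a0 * c + b0)\<bar>) \<longlonglongrightarrow> \<bar>a0 * c + b0 - (a0 * c + b0)\<bar>"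
    using a b by (intro tendsto_intros)
  then have 2: "\<forall>\<^sub>F n in sequentially. \<bar>a n * c + b n - (a0 * c + b0)\<bar> < \<epsilon> / 2"
    by (rule order_tendstoD) (use \<open>\<epsilon> > 0\<close> in simp)
  \<comment> \<open>The deterministic part eventually uses less than half of \<epsilon>. The random
    part must then exceed the other half, and dividing by \<open>K\<close> gives this threshold for
    \<open>T n\<close>.\<close>
  have lim: "(\<lambda>n. prob {\<omega> \<in> space M. \<bar>T n \<omega> - c\<bar> > \<epsilon> / (2 * K)}) \<longlonglongrightarrow> 0"
    using T \<open>\<epsilon> > 0\<close> \<open>K > 0\<close> by (simp add: tendsto_in_prob_def)
  have "\<forall>\<^sub>F n in sequentially. prob {\<omega> \<in> space M. \<bar>a n * T n \<omega> + b n - (a0 * c + b0)\<bar> > \<epsilon>}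
      \<le> prob {\<omega> \<in> space M. \<bar>T n \<omega> - c\<bar> > \<epsilon> / (2 * K)}"
    using 1 2
  proof eventually_elim
    case (elim n)
    have "\<bar>T n \<omega> - c\<bar> > \<epsilon> / (2 * K)" if "\<bar>a n * T n \<omega> + b n - (a0 * c + b0)\<bar> > \<epsilon>" for \<omega>
    proof -
      have "a n * T n \<omega> + b n - (a0 * c + b0)
          = a n * (T n \<omega> - c) + (a n * c + b n - (a0 * c + b0))"
        by (simp add: algebra_simps)
      with that elim have "\<epsilon> / 2 < \<bar>a n * (T n \<omega> - c)\<bar>" by linarith
      also have "\<dots> \<le> K * \<bar>T n \<omega> - c\<bar>"
        using elim by (simp add: abs_mult mult_right_mono)
      finally show ?thesis using \<open>K > 0\<close> by (simp add: field_simps)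
    qed
    then show ?case by (intro finite_measure_mono) auto
  qed
  then show "(\<lambda>n. prob {\<omega> \<in> space M. \<bar>a n * T n \<omega> + b n - (a0 * c + b0)\<bar> > \<epsilon>}) \<longlonglongrightarrow> 0"
    by (intro tendsto_sandwich[OF _ _ tendsto_const lim]) auto
qed

text \<open>The indicators \<open>Z i\<close> inherit independence and a common law from the
  observations, take values in [0, 1] and have mean \<open>p\<close>, so the deviation probability
  decays exponentially in n.\<close>

lemma relative_frequency_tendsto_in_prob:
  fixes X :: "nat \<Rightarrow> 'a \<Rightarrow> real"
  assumes "prob_space M"
    and indep: "prob_space.indep_vars M (\<lambda>_. borel) X {1..}"
    and distr: "\<And>i. i \<ge> 1 \<Longrightarrow> distr M borel (X i) = distr M borel (X 1)"
  shows "tendsto_in_prob M (\<lambda>n \<omega>. (\<Sum>i=1..n. of_bool (X i \<omega> \<le> x)) / real n)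
    (cdf (distr M borel (X 1)) x)"
  unfolding tendsto_in_prob_def
proof (intro conjI allI impI)
  interpret prob_space M by fact
  have X [measurable]: "X i \<in> borel_measurable M" if "i \<ge> 1" for i
    using indep that unfolding indep_vars_def by auto
  define Z :: "nat \<Rightarrow> 'a \<Rightarrow> real" where "Z i \<omega> = of_bool (X i \<omega> \<le> x)" for i \<omega>
  have Z [measurable]: "Z i \<in> borel_measurable M" if "i \<ge> 1" for i
    using that unfolding Z_def by measurable
  define p where "p = cdf (distr M borel (X 1)) x"
  have p: "expectation (Z 1) = p"
  proof -
    have "expectation (Z 1) = expectation (indicator {\<omega> \<in> space M. X 1 \<omega> \<le> x})"
      by (intro Bochner_Integration.integral_cong) (auto simp: Z_def)
    also have "\<dots> = prob {\<omega> \<in> space M. X 1 \<omega> \<le> x}"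
      by simp
    also have "\<dots> = p"
      unfolding p_def cdf_def
      by (subst measure_distr) (auto intro!: arg_cong[where f = prob])
    finally show ?thesis .
  qed
  have indep_Z: "indep_vars (\<lambda>_. borel) Z {1..}"
    unfolding Z_def by (rule indep_vars_compose2[OF indep]) measurable
  have distr_Z: "distr M borel (Z i) = distr M borel (Z 1)" if "i \<ge> 1" for i
  proof -
    \<comment> \<open>The law of \<open>Z j\<close> is the image of the law of \<open>X j\<close>
      under a map that does not depend on \<open>j\<close>, so equal laws of the observations give
      equal laws of the indicators.\<close>
    have "distr M borel (Z j) = distr (distr M borel (X j)) borel (\<lambda>y. of_bool (y \<le> x))"
      if "j \<ge> 1" for j
      using that by (subst distr_distr) (auto simp: Z_def[abs_def] o_def)
    then show ?thesis using distr[OF that] that by simp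
  qed
  show "(\<lambda>\<omega>. (\<Sum>i=1..n. of_bool (X i \<omega> \<le> x)) / real n) \<in> borel_measurable M" for n
    using Z unfolding Z_def by (intro borel_measurable_divide borel_measurable_sum) auto
  fix \<epsilon> :: real assume "\<epsilon> > 0"
  have "prob {\<omega> \<in> space M. \<bar>(\<Sum>i=1..n. Z i \<omega>) / real n - p\<bar> > \<epsilon>}
      \<le> 2 * exp (- 2 * real n * \<epsilon>\<^sup>2)" if "n \<ge> 1" for n
  proof -
    \<comment> \<open>The range [0, 1] has width 1, so the squared width dividing Hoeffding's
      exponent disappears.\<close>
    interpret Z: Hoeffding_ineq_iid M "{1..n}" Z "Z 1" 0 1 p
    proof unfold_locales
      show "indep_vars (\<lambda>_. borel) Z {1..n}"
        by (rule indep_vars_subset[OF indep_Z]) auto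
      show "distr M borel (Z i) = distr M borel (Z 1)" if "i \<in> {1..n}" for i
        using that by (intro distr_Z) auto
    qed (auto simp: Z_def[abs_def] p[symmetric])
    \<comment> \<open>Convergence in probability is stated with a strict inequality, the Hoeffding
      bound with a weak one; the weak event is the larger.\<close>
    have "prob {\<omega> \<in> space M. \<bar>(\<Sum>i=1..n. Z i \<omega>) / real n - p\<bar> > \<epsilon>}
        \<le> prob {\<omega> \<in> space M. \<bar>(\<Sum>i=1..n. Z i \<omega>) / real n - p\<bar> \<ge> \<epsilon>}"
      by (intro finite_measure_mono) auto
    also have "\<dots> \<le> 2 * exp (- 2 * real n * \<epsilon>\<^sup>2)"
      using Z.Hoeffding_ineq_abs_ge'[of \<epsilon>] \<open>\<epsilon> > 0\<close> that by simp
    finally show ?thesis .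
  qed
  then have bound: "\<forall>\<^sub>F n in sequentially.
      prob {\<omega> \<in> space M. \<bar>(\<Sum>i=1..n. Z i \<omega>) / real n - p\<bar> > \<epsilon>} \<le> 2 * exp (- 2 * real n * \<epsilon>\<^sup>2)"
    by (rule eventually_sequentiallyI)
  have "(\<lambda>n. 2 * exp (- 2 * real n * \<epsilon>\<^sup>2)) \<longlonglongrightarrow> 0"
    using \<open>\<epsilon> > 0\<close> by real_asymp
  from tendsto_sandwich[OF _ bound tendsto_const this]
  show "(\<lambda>n. prob {\<omega> \<in> space M. \<bar>(\<Sum>i=1..n. of_bool (X i \<omega> \<le> x)) / real n
      - cdf (distr M borel (X 1)) x\<bar> > \<epsilon>}) \<longlonglongrightarrow> 0"
    by (simp add: Z_def p_def)
qed

text \<open>All four estimators have this shape, with (u, v) equal to (1, 0), (1/3, 1/3), (-1, 1)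
  and (0, 1/2). Here \<open>a n = n / (n + u)\<close> and
  \<open>b n = - v / (n + u)\<close>.\<close>

lemma consistent_estimator_shifted_frequency:
  fixes X :: "nat \<Rightarrow> 'a \<Rightarrow> real" and u v :: real
  assumes "prob_space M"
    and "prob_space.indep_vars M (\<lambda>_. borel) X {1..}"
    and "\<And>i. i \<ge> 1 \<Longrightarrow> distr M borel (X i) = distr M borel (X 1)"
  shows "consistent_estimator M X
    (\<lambda>n s. 1 / (real n + u) * ((\<Sum>i=1..n. of_bool (s i \<le> x)) - v))
    (cdf (distr M borel (X 1)) x)"
proof -
  have "(\<lambda>n. real n / (real n + u)) \<longlonglongrightarrow> 1" "(\<lambda>n. - v / (real n + u)) \<longlonglongrightarrow> 0"
    by real_asymp+
  from tendsto_in_prob_affine[OF assms(1) relative_frequency_tendsto_in_prob[OF assms] this]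
  have "tendsto_in_prob M
      (\<lambda>n \<omega>. real n / (real n + u) * ((\<Sum>i=1..n. of_bool (X i \<omega> \<le> x)) / real n) + - v / (real n + u))
      (cdf (distr M borel (X 1)) x)"
    by simp
  \<comment> \<open>This holds for every n, not just eventually. At \<open>n = 0\<close> the sum is
    empty and both sides are \<open>- v / u\<close>; where \<open>real n + u = 0\<close>, division
    by zero makes both sides 0.\<close>
  moreover have "real n / (real n + u) * ((\<Sum>i=1..n. of_bool (X i \<omega> \<le> x)) / real n) + - v / (real n + u)
      = 1 / (real n + u) * ((\<Sum>i=1..n. of_bool ((\<lambda>i\<in>{1..n}. X i \<omega>) i \<le> x)) - v)" for n \<omega>
  proof -
    have "(\<Sum>i=1..n. of_bool ((\<lambda>i\<in>{1..n}. X i \<omega>) i \<le> x)) = (\<Sum>i=1..n. of_bool (X i \<omega> \<le> x) :: real)"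
      by (intro sum.cong) auto
    then show ?thesis
      by (cases "n = 0") (simp_all add: diff_divide_distrib)
  qed
  ultimately show ?thesis
    unfolding consistent_estimator_def by (simp only:)
qed

theorem mainTheorem2:
  fixes M :: "'a measure" and X :: "nat \<Rightarrow> 'a \<Rightarrow> real" and F :: "real \<Rightarrow> real" and x :: real
  assumes "prob_space M"
    and "prob_space.indep_vars M (\<lambda>_. borel) X {1..}"
    and "\<And>i. i \<ge> 1 \<Longrightarrow> distr M borel (X i) = distr M borel (X 1)"
    and "F = cdf (distr M borel (X 1))"
  shows "consistent_estimator M X (F_est1 x) (F x) \<and>
         consistent_estimator M X (F_est2 x) (F x) \<and>
         consistent_estimator M X (F_est3 x) (F x) \<and>
         consistent_estimator M X (F_est4 x) (F x)"
proof -
  note consistent = consistent_estimator_shifted_frequency[OF assms(1-3), where x = x]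
  \<comment> \<open>The redundant \<open>- 0\<close>, \<open>+ - 1\<close> and \<open>+ 0\<close>
    make each estimator an instance of the general shape, so that \<open>consistent\<close> applies
    by plain rewriting.\<close>
  have "F_est1 x = (\<lambda>n s. 1 / (real n + 1) * ((\<Sum>i=1..n. of_bool (s i \<le> x)) - 0))"
    "F_est2 x = (\<lambda>n s. 1 / (real n + 1 / 3) * ((\<Sum>i=1..n. of_bool (s i \<le> x)) - 1 / 3))"
    "F_est3 x = (\<lambda>n s. 1 / (real n + - 1) * ((\<Sum>i=1..n. of_bool (s i \<le> x)) - 1))"
    "F_est4 x = (\<lambda>n s. 1 / (real n + 0) * ((\<Sum>i=1..n. of_bool (s i \<le> x)) - 1 / 2))"
    by (simp_all add: fun_eq_iff F_est1_def F_est2_def F_est3_def F_est4_def)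
  then show ?thesis
    by (simp only: assms(4) consistent simp_thms)
qed

end
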